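(* Let $S=\{x_1,\dots,x_n\}\subset\mathbb{R}^2$ be a set of $n\ge2$ distinct points in general position, let $p\in\mathbb{R}^2$ be a point, and let $r(S)=\min_x\max_i\|x-x_i\|$ be the radius of the minimum enclosing circle of $S$. When $0<C\le 2r(S)$, the problem $$M(W_1):\quad \max_{x}\frac{\|x-p\|}{\max_i\|x-x_i\|}$$ is equivalent to the problem $$M(P):\quad \max_{R,s}\ \|TRE(p)\|\qquad\text{s.t.}\quad \|TRE(x_i)\|\le C\quad \forall\, x_i\in S .$$
   Context: $\|\cdot\|$ is the Euclidean norm. $S$ is in general position if no four of its points are co-circular. A 2D rigid motion is $q\mapsto Rq+s$, where $R=\begin{pmatrix}\cos\theta&-\sin\theta\\ \sin\theta&\cos\theta\end{pmatrix}$ is the rotation matrix with rotation angle $\theta$ and $s\in\mathbb{R}^2$ is the translation term. The Target Registration Error of a point $q\in\mathbb{R}^2$ under this motion is $TRE(q)=Rq+s-q$, so $\|TRE(q)\|$ is the displacement of $q$. In $M(P)$ the maximum is over all rotation matrices $R$ and translation terms $s$, and $C$ is the maximum displacement allowed for the points of $S$. In $M(W_1)$ the variable $x$ ranges over the Euclidean plane; the point $x=\infty$ is also admitted as a possible optimal solution, with the limiting objective value $1$. *)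

theory Defs
  imports "HOL-Analysis.Analysis"
begin

definition general_position :: "(real^2) set \<Rightarrow> bool" where
  "general_position S \<longleftrightarrow> \<not> (\<exists>T c \<rho>. T \<subseteq> S \<and> card T = 4 \<and> T \<subseteq> sphere c \<rho>)"

definition farthest_dist :: "(real^2) set \<Rightarrow> real^2 \<Rightarrow> real" where
  "farthest_dist S x = Max ((\<lambda>y. norm (x - y)) ` S)"

text \<open>The infimum is attained for finite nonempty sets; see
  \<open>enclosing_radius_attained\<close> below.\<close>

definition enclosing_radius :: "(real^2) set \<Rightarrow> real" where
  "enclosing_radius S = (INF x. farthest_dist S x)"

definition rot_matrix :: "real \<Rightarrow> real^2^2" where
  "rot_matrix \<theta> = vector [vector [cos \<theta>, - sin \<theta>], vector [sin \<theta>, cos \<theta>]]"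

definition TRE :: "real^2^2 \<Rightarrow> real^2 \<Rightarrow> real^2 \<Rightarrow> real^2" where
  "TRE R s q = R *v q + s - q"

definition P_feasible :: "(real^2) set \<Rightarrow> real \<Rightarrow> (real^2^2) \<times> (real^2) \<Rightarrow> bool" where
  "P_feasible S C = (\<lambda>(R, s). R \<in> range rot_matrix \<and> (\<forall>y\<in>S. norm (TRE R s y) \<le> C))"

definition P_optimal ::
    "(real^2) set \<Rightarrow> real^2 \<Rightarrow> real \<Rightarrow> real^2^2 \<Rightarrow> real^2 \<Rightarrow> bool" where
  "P_optimal S p C R s \<longleftrightarrow>
     is_arg_max (\<lambda>(R, s). norm (TRE R s p)) (P_feasible S C) (R, s)"

text \<open>The decision variable \<open>x\<close> below ranges over the plane extended by a point at
  infinity, encoded by \<open>None\<close> as in \<open>Alexandroff_compactification\<close>; the value there is the limit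
  established in \<open>W1_objective_limit\<close>.\<close>

fun W1_objective :: "(real^2) set \<Rightarrow> real^2 \<Rightarrow> (real^2) option \<Rightarrow> real" where
  "W1_objective S p (Some x) = norm (x - p) / farthest_dist S x"
| "W1_objective S p None = 1"

definition W1_optimal :: "(real^2) set \<Rightarrow> real^2 \<Rightarrow> (real^2) option \<Rightarrow> bool" where
  "W1_optimal S p x \<longleftrightarrow> is_arg_max (W1_objective S p) (\<lambda>_. True) x"

text \<open>A motion with a nontrivial rotation has exactly one fixed point, its centre of rotation;
  a translation is a rotation about the point at infinity.\<close>

fun motion_centre :: "real^2^2 \<Rightarrow> real^2 \<Rightarrow> (real^2) option \<Rightarrow> bool" where
  "motion_centre R s (Some x) \<longleftrightarrow> R *v x + s = x"
| "motion_centre R s None \<longleftrightarrow> R = mat 1"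

lemma farthest_dist_lipschitz:
  assumes "finite S" "S \<noteq> {}"
  shows "\<bar>farthest_dist S x - norm (x - p)\<bar> \<le> farthest_dist S p"
    and "farthest_dist S x \<le> farthest_dist S z + norm (x - z)"
proof -
  have le: "norm (u - y) \<le> farthest_dist S u" if "y \<in> S" for u y
    unfolding farthest_dist_def using assms that by (intro Max_ge) auto
  have ub: "farthest_dist S u \<le> farthest_dist S v + norm (u - v)" for u v
  proof -
    have "norm (u - y) \<le> farthest_dist S v + norm (u - v)" if "y \<in> S" for y
      using le[OF that, of v] norm_triangle_ineq[of "u - v" "v - y"] by simp
    then show ?thesis
      unfolding farthest_dist_def[of S u] using assms by (subst Max_le_iff) auto
  qed
  show "farthest_dist S x \<le> farthest_dist S z + norm (x - z)" by (rule ub)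
  obtain y where y: "y \<in> S" using assms by blast
  have "norm (x - p) \<le> norm (x - y) + norm (p - y)"
    using norm_triangle_ineq4[of "x - y" "p - y"] by simp
  with le[OF y, of x] le[OF y, of p] ub[of x p]
  show "\<bar>farthest_dist S x - norm (x - p)\<bar> \<le> farthest_dist S p" by linarith
qed

lemma enclosing_radius_attained:
  assumes "finite S" "S \<noteq> {}"
  shows "\<exists>x. farthest_dist S x = enclosing_radius S \<and> (\<forall>z. farthest_dist S x \<le> farthest_dist S z)"
proof -
  let ?f = "farthest_dist S" and ?K = "cball 0 (2 * farthest_dist S 0)"
  have lip: "\<bar>?f x - ?f z\<bar> \<le> dist x z" for x z
    using farthest_dist_lipschitz(2)[OF assms, of x z] farthest_dist_lipschitz(2)[OF assms, of z x]
    by (simp add: dist_norm norm_minus_commute)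
  have cont: "continuous_on ?K ?f"
    unfolding continuous_on_iff dist_real_def using lip by (meson le_less_trans dist_commute)
  have nn: "0 \<le> ?f 0"
    using farthest_dist_lipschitz(1)[OF assms, of 0 0] by simp
  then obtain x where x: "x \<in> ?K" "\<And>z. z \<in> ?K \<Longrightarrow> ?f x \<le> ?f z"
    using continuous_attains_inf[OF compact_cball _ cont] by force
  have min: "?f x \<le> ?f z" for z
  proof (cases "z \<in> ?K")
    case False
    then have "?f 0 \<le> ?f z"
      using farthest_dist_lipschitz(1)[OF assms, of z 0] by simp
    moreover have "?f x \<le> ?f 0" using x(2)[of 0] nn by simp
    ultimately show ?thesis by simp
  qed (use x in blast)
  have "enclosing_radius S = ?f x"
    unfolding enclosing_radius_def using min by (intro cInf_eq_minimum) auto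
  with min show ?thesis by metis
qed

lemma W1_objective_limit:
  assumes "finite S" "S \<noteq> {}"
  shows "((\<lambda>x. W1_objective S p (Some x)) \<longlongrightarrow> W1_objective S p None) at_infinity"
proof -
  let ?f = "farthest_dist S" and ?B = "farthest_dist S p"
  have "filterlim (\<lambda>x. ?f x) at_top at_infinity"
  proof (rule filterlim_at_top_mono)
    show "filterlim (\<lambda>x. - (norm p + ?B) + norm x) at_top at_infinity"
      by (intro filterlim_tendsto_add_at_top[OF tendsto_const] filterlim_norm_at_top)
    show "\<forall>\<^sub>F x in at_infinity. - (norm p + ?B) + norm x \<le> ?f x"
    proof (rule always_eventually, rule allI)
      fix x show "- (norm p + ?B) + norm x \<le> ?f x"
        using farthest_dist_lipschitz(1)[OF assms, of x p] norm_triangle_ineq2[of x p] by linarith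
    qed
  qed
  then have pos: "\<forall>\<^sub>F x in at_infinity. 0 < ?f x"
    and lim: "((\<lambda>x. ?B / ?f x) \<longlongrightarrow> 0) at_infinity"
    by (auto simp: filterlim_at_top_dense intro: real_tendsto_divide_at_top[OF tendsto_const])
  have "((\<lambda>x. norm (x - p) / ?f x - 1) \<longlongrightarrow> 0) at_infinity"
  proof (rule Lim_null_comparison[OF _ lim])
    show "\<forall>\<^sub>F x in at_infinity. norm (norm (x - p) / ?f x - 1) \<le> ?B / ?f x"
      using pos
    proof eventually_elim
      case (elim x)
      then have "norm (x - p) / ?f x - 1 = (norm (x - p) - ?f x) / ?f x"
        by (simp add: diff_divide_distrib)
      with elim have "norm (norm (x - p) / ?f x - 1) = \<bar>?f x - norm (x - p)\<bar> / ?f x"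
        by (simp add: abs_minus_commute)
      with elim show ?case
        using farthest_dist_lipschitz(1)[OF assms, of x p] by (simp add: divide_right_mono)
    qed
  qed
  then show ?thesis by (simp add: LIM_zero_iff)
qed

end

theory Submission
  imports Defs
begin

text \<open>A rotation by \<open>\<theta>\<close> about \<open>x\<close> displaces \<open>q\<close> by \<open>2 \<bar>sin (\<theta>/2)\<bar> \<parallel>q - x\<parallel>\<close> and a
  translation displaces all points equally, so the displacement of \<open>p\<close> is always the largest
  displacement over \<open>S\<close> times the \<open>W1\<close> objective at the centre. The bound \<open>C \<le> 2 r(S)\<close> is what
  allows every centre to be used with largest displacement exactly \<open>C\<close>. Maximising over
  motions therefore amounts to maximising over centres.\<close>

section \<open>Plane rotations: displacement and fixed points\<close>

lemma norm_vec2_squared: "(norm (v :: real^2))\<^sup>2 = (v$1)\<^sup>2 + (v$2)\<^sup>2"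
  unfolding power2_norm_eq_inner by (simp add: inner_vec_def sum_2 power2_eq_square)

lemma rot_matrix_mult:
  "(rot_matrix \<theta> *v v) $ 1 = cos \<theta> * v$1 - sin \<theta> * v$2"
  "(rot_matrix \<theta> *v v) $ 2 = sin \<theta> * v$1 + cos \<theta> * v$2"
  by (simp_all add: rot_matrix_def matrix_vector_mult_def sum_2)

lemma rot_matrix_eq_mat_1:
  assumes "cos \<theta> = 1"
  shows "rot_matrix \<theta> = mat 1"
proof -
  have "sin \<theta> = 0" using sin_cos_squared_add[of \<theta>] assms by simp
  with assms show ?thesis
    by (simp add: rot_matrix_def mat_def vec_eq_iff forall_2)
qed

text \<open>This is the length of the chord subtending the angle \<theta> on the circle of radius
  \<open>norm v\<close>. After squaring, it is the half-angle identity for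
  \<open>2 - 2 * cos \<theta>\<close>.\<close>

lemma norm_rot_matrix_displacement:
  "norm (rot_matrix \<theta> *v v - v) = 2 * \<bar>sin (\<theta> / 2)\<bar> * norm v"
proof -
  have half: "2 - 2 * cos \<theta> = (2 * \<bar>sin (\<theta> / 2)\<bar>)\<^sup>2"
    using cos_double_sin[of "\<theta> / 2"] by (simp add: power_mult_distrib)
  have "(norm (rot_matrix \<theta> *v v - v))\<^sup>2
      = ((cos \<theta>)\<^sup>2 + (sin \<theta>)\<^sup>2 + 1 - 2 * cos \<theta>) * ((v$1)\<^sup>2 + (v$2)\<^sup>2)"
    unfolding norm_vec2_squared vector_minus_component rot_matrix_mult
    by algebra
  also have "\<dots> = (2 - 2 * cos \<theta>) * ((v$1)\<^sup>2 + (v$2)\<^sup>2)" by simp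
  also have "\<dots> = (2 * \<bar>sin (\<theta> / 2)\<bar> * norm v)\<^sup>2"
    unfolding half norm_vec2_squared[symmetric] by (simp only: power_mult_distrib)
  finally show ?thesis by (rule power2_eq_imp_eq) simp_all
qed

text \<open>A fixed point solves the linear system (I - R) x = s, which is singular only when
  \<open>cos \<theta> = 1\<close>. In that case R is the identity and the centre lies at
  infinity.\<close>

lemma rotation_has_centre:
  assumes "R \<in> range rot_matrix"
  shows "\<exists>x. motion_centre R s x"
proof -
  obtain \<theta> where R: "R = rot_matrix \<theta>" using assms by blast
  show ?thesis
  proof (cases "cos \<theta> = 1")
    case True
    then have "motion_centre R s None" using R rot_matrix_eq_mat_1 by simp
    then show ?thesis ..
  next
    case False
    \<comment> \<open>The determinant of I - R; \<open>x\<close> below is the solution given by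
      Cramer's rule.\<close>
    define d where "d = 2 - 2 * cos \<theta>"
    have d: "d \<noteq> 0" using False by (simp add: d_def)
    have sc: "(sin \<theta>)\<^sup>2 = 1 - (cos \<theta>)\<^sup>2" by (simp add: sin_squared_eq)
    define x :: "real^2" where "x = vector [((1 - cos \<theta>) * s$1 - sin \<theta> * s$2) / d,
                                 (sin \<theta> * s$1 + (1 - cos \<theta>) * s$2) / d]"
    have x1: "x$1 * d = (1 - cos \<theta>) * s$1 - sin \<theta> * s$2"
      and x2: "x$2 * d = sin \<theta> * s$1 + (1 - cos \<theta>) * s$2"
      using d by (simp_all add: x_def)
    \<comment> \<open>Multiplying the fixed-point equation by \<open>d\<close> clears denominators,
      leaving a polynomial identity that vanishes by \<open>sc\<close>.\<close>
    have "d * (cos \<theta> * x$1 - sin \<theta> * x$2 + s$1 - x$1)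
        = (cos \<theta> - 1) * (x$1 * d) - sin \<theta> * (x$2 * d) + d * s$1"
      by (simp add: algebra_simps)
    also have "\<dots> = (1 - (cos \<theta>)\<^sup>2 - (sin \<theta>)\<^sup>2) * s$1"
      unfolding x1 x2 unfolding d_def by algebra
    finally have "cos \<theta> * x$1 - sin \<theta> * x$2 + s$1 = x$1"
      using d by (simp add: sc)
    moreover have "d * (sin \<theta> * x$1 + cos \<theta> * x$2 + s$2 - x$2)
        = sin \<theta> * (x$1 * d) + (cos \<theta> - 1) * (x$2 * d) + d * s$2"
      by (simp add: algebra_simps)
    then have "d * (sin \<theta> * x$1 + cos \<theta> * x$2 + s$2 - x$2)
        = (1 - (cos \<theta>)\<^sup>2 - (sin \<theta>)\<^sup>2) * s$2"
      unfolding x1 x2 unfolding d_def by algebra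
    then have "sin \<theta> * x$1 + cos \<theta> * x$2 + s$2 = x$2"
      using d by (simp add: sc)
    ultimately have "R *v x + s = x"
      by (simp add: R vec_eq_iff forall_2 rot_matrix_mult)
    then have "motion_centre R s (Some x)" by simp
    then show ?thesis ..
  qed
qed

lemma norm_TRE_centre:
  assumes "R *v x + s = x"
  shows "norm (TRE R s q) = norm (R *v (q - x) - (q - x))"
proof -
  have "TRE R s q = R *v (q - x) - (q - x)"
    using assms by (simp add: TRE_def matrix_vector_mult_diff_distrib algebra_simps)
  then show ?thesis by simp
qed

section \<open>Largest displacement over S and its relation to the centre\<close>

definition max_TRE :: "(real^2) set \<Rightarrow> real^2^2 \<Rightarrow> real^2 \<Rightarrow> real" where
  "max_TRE S R s = Max ((\<lambda>y. norm (TRE R s y)) ` S)"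

text \<open>Every displacement is the distance to the centre times one common factor; being
  nonnegative, the factor can be pulled out of the maximum.\<close>

lemma max_TRE_rotation:
  assumes "finite S" "S \<noteq> {}" "rot_matrix \<theta> *v x + s = x"
  shows "max_TRE S (rot_matrix \<theta>) s = 2 * \<bar>sin (\<theta> / 2)\<bar> * farthest_dist S x"
proof -
  let ?k = "2 * \<bar>sin (\<theta> / 2)\<bar>" and ?D = "(\<lambda>y. norm (x - y)) ` S"
  have "norm (TRE (rot_matrix \<theta>) s y) = ?k * norm (x - y)" for y
    unfolding norm_TRE_centre[OF assms(3)] norm_rot_matrix_displacement norm_minus_commute[of y x] ..
  then have "max_TRE S (rot_matrix \<theta>) s = Max ((*) ?k ` ?D)"
    by (simp add: max_TRE_def image_image)
  also have "\<dots> = ?k * Max ?D"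
    using assms(1,2) by (intro mono_Max_commute[symmetric] monoI mult_left_mono) auto
  finally show ?thesis by (simp add: farthest_dist_def)
qed

lemma TRE_mat_1 [simp]: "TRE (mat 1) s q = s"
  by (simp add: TRE_def)

lemma max_TRE_translation:
  assumes "S \<noteq> {}"
  shows "max_TRE S (mat 1) s = norm s"
  using assms by (simp add: max_TRE_def image_constant_conv)

lemma max_TRE_le_iff:
  assumes "finite S" "S \<noteq> {}"
  shows "max_TRE S R s \<le> C \<longleftrightarrow> (\<forall>y\<in>S. norm (TRE R s y) \<le> C)"
  unfolding max_TRE_def using assms by simp

lemma max_TRE_nonneg:
  assumes "finite S" "S \<noteq> {}"
  shows "0 \<le> max_TRE S R s"
proof -
  obtain y where "y \<in> S" using assms by blast
  then have "norm (TRE R s y) \<le> max_TRE S R s"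
    unfolding max_TRE_def using assms by (intro Max_ge) auto
  then show ?thesis using norm_ge_zero order_trans by blast
qed

text \<open>At most one point of \<open>S\<close> can coincide with \<open>x\<close>. This makes the
  quotient in the objective a genuine division.\<close>

lemma farthest_dist_pos:
  assumes "finite S" "2 \<le> card S"
  shows "0 < farthest_dist S x"
proof (rule ccontr)
  assume "\<not> 0 < farthest_dist S x"
  moreover have "norm (x - y) \<le> farthest_dist S x" if "y \<in> S" for y
    unfolding farthest_dist_def using assms that by (intro Max_ge) auto
  ultimately have "norm (x - y) \<le> 0" if "y \<in> S" for y
    using that by (meson not_less order_trans)
  then have "S \<subseteq> {x}" by auto
  then have "card S \<le> 1" using card_mono[of "{x}" S] by simp
  then show False using assms by simp
qed

text \<open>For a finite centre both displacements carry the factor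
  \<open>2 * \<bar>sin (\<theta> / 2)\<bar>\<close>, and the farthest distance cancels. For a
  translation both equal \<open>norm s\<close>, matching the value 1 at infinity.\<close>

lemma norm_TRE_eq_W1_objective:
  assumes "finite S" "2 \<le> card S" "R \<in> range rot_matrix" "motion_centre R s x"
  shows "norm (TRE R s p) = max_TRE S R s * W1_objective S p x"
proof -
  have ne: "S \<noteq> {}" using assms by auto
  show ?thesis
  proof (cases x)
    case None
    then show ?thesis using assms ne by (simp add: max_TRE_translation)
  next
    case (Some z)
    obtain \<theta> where R: "R = rot_matrix \<theta>" using assms by blast
    have c: "rot_matrix \<theta> *v z + s = z" using assms Some R by simp
    show ?thesis
      using farthest_dist_pos[OF assms(1,2), of z]
      by (simp add: R Some max_TRE_rotation[OF assms(1) ne c] norm_TRE_centre[OF c]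
          norm_rot_matrix_displacement norm_minus_commute[of z p])
  qed
qed

text \<open>The rotation about a finite centre must have chord factor C divided by the farthest
  distance. Since that distance is at least the enclosing radius, the factor is at most 2, the
  maximum of \<open>2 * \<bar>sin (\<theta> / 2)\<bar>\<close>.\<close>

lemma motion_with_centre_exists:
  assumes "finite S" "2 \<le> card S" "0 < C" "C \<le> 2 * enclosing_radius S"
  shows "\<exists>R\<in>range rot_matrix. \<exists>s. motion_centre R s x \<and> max_TRE S R s = C"
proof -
  have ne: "S \<noteq> {}" using assms by auto
  show ?thesis
  proof (cases x)
    case None
    obtain s :: "real^2" where "norm s = C"
      using vector_choose_size[of C] assms by auto
    moreover have "mat 1 \<in> range rot_matrix"
      using rot_matrix_eq_mat_1[of 0] by (metis cos_zero rangeI)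
    ultimately show ?thesis
      using None max_TRE_translation[OF ne] by (intro bexI[of _ "mat 1"] exI[of _ s]) auto
  next
    case (Some z)
    define k where "k = C / farthest_dist S z"
    have pos: "0 < farthest_dist S z" by (rule farthest_dist_pos[OF assms(1,2)])
    have "enclosing_radius S \<le> farthest_dist S z"
      using enclosing_radius_attained[OF assms(1) ne] by metis
    then have k: "0 \<le> k" "k \<le> 2" using pos assms by (simp_all add: k_def divide_simps)
    \<comment> \<open>The angle whose chord factor is \<open>k\<close>; the bounds in
      \<open>k\<close> put \<open>k / 2\<close> in the domain of \<open>arcsin\<close>.\<close>
    define \<theta> where "\<theta> = 2 * arcsin (k / 2)"
    define s where "s = z - rot_matrix \<theta> *v z"
    have c: "rot_matrix \<theta> *v z + s = z" by (simp add: s_def)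
    have "2 * \<bar>sin (\<theta> / 2)\<bar> = k" using k by (simp add: \<theta>_def)
    then have "max_TRE S (rot_matrix \<theta>) s = C"
      using max_TRE_rotation[OF assms(1) ne c] pos by (simp add: k_def)
    then show ?thesis using c Some by auto
  qed
qed

section \<open>Existence of an optimal centre\<close>

lemma continuous_W1_objective:
  assumes "finite S" "2 \<le> card S"
  shows "continuous_on UNIV (\<lambda>x. W1_objective S p (Some x))"
proof -
  have ne: "S \<noteq> {}" using assms by auto
  have "\<bar>farthest_dist S x - farthest_dist S z\<bar> \<le> dist x z" for x z
    using farthest_dist_lipschitz(2)[OF assms(1) ne, of x z]
      farthest_dist_lipschitz(2)[OF assms(1) ne, of z x]
    by (simp add: dist_norm norm_minus_commute)
  then have "continuous_on UNIV (farthest_dist S)"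
    unfolding continuous_on_iff dist_real_def by (meson le_less_trans dist_commute)
  then show ?thesis
    using farthest_dist_pos[OF assms]
    by (auto intro!: continuous_intros simp: less_imp_neq[THEN not_sym])
qed

lemma W1_optimal_iff:
  "W1_optimal S p x \<longleftrightarrow> (\<forall>z. W1_objective S p z \<le> W1_objective S p x)"
  by (auto simp: W1_optimal_def is_arg_max_def not_less)

text \<open>If infinity is not optimal, some finite point has value above 1. As the limit at
  infinity is 1, competitors are confined to a compact ball, where continuity gives a
  maximum.\<close>

lemma W1_optimal_exists:
  assumes "finite S" "2 \<le> card S"
  shows "\<exists>x. W1_optimal S p x"
proof (cases "W1_optimal S p None")
  case False
  let ?w = "\<lambda>x. W1_objective S p (Some x)"
  obtain y where y: "1 < W1_objective S p y"
    using False by (auto simp: W1_optimal_iff not_le)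
  then obtain a where a: "1 < ?w a" by (cases y) auto
  have ne: "S \<noteq> {}" using assms by auto
  have "\<forall>\<^sub>F x in at_infinity. ?w x < ?w a"
    using W1_objective_limit[OF assms(1) ne] a by (intro order_tendstoD(2)) auto
  then obtain B where B: "\<And>x. B \<le> norm x \<Longrightarrow> ?w x < ?w a"
    by (auto simp: eventually_at_infinity)
  have "norm a < B" using B[of a] by force
  then have "a \<in> cball 0 B" by simp
  moreover have "continuous_on (cball 0 B) ?w"
    using continuous_W1_objective[OF assms] continuous_on_subset by blast
  ultimately have "\<exists>x\<in>cball 0 B. \<forall>z\<in>cball 0 B. ?w z \<le> ?w x"
    by (intro continuous_attains_sup compact_cball) blast+
  then obtain x where x: "\<And>z. z \<in> cball 0 B \<Longrightarrow> ?w z \<le> ?w x" by blast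
  have xa: "?w a \<le> ?w x" using x \<open>a \<in> cball 0 B\<close> by blast
  have "W1_objective S p z \<le> ?w x" for z
  proof (cases z)
    case (Some u)
    then show ?thesis using x[of u] B[of u] xa by (cases "norm u \<le> B") auto
  qed (use a xa in auto)
  then show ?thesis unfolding W1_optimal_iff by blast
qed blast

section \<open>Optimal motions versus optimal centres\<close>

text \<open>The optimal value of the motion problem is C times that of the centre problem: the
  factorisation through a centre bounds it above, and a motion centred at \<open>z\<close> with
  largest displacement C attains it.\<close>

lemma P_optimal_iff:
  assumes "finite S" "2 \<le> card S" "0 < C" "C \<le> 2 * enclosing_radius S"
    and opt: "W1_optimal S p z"
  shows "P_optimal S p C R s \<longleftrightarrow> R \<in> range rot_matrix \<and> max_TRE S R s \<le> C
           \<and> norm (TRE R s p) = C * W1_objective S p z"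
proof -
  let ?M = "W1_objective S p z"
  have ne: "S \<noteq> {}" using assms by auto
  have feas: "P_feasible S C (R, s) \<longleftrightarrow> R \<in> range rot_matrix \<and> max_TRE S R s \<le> C" for R s
    by (simp add: P_feasible_def max_TRE_le_iff[OF assms(1) ne])
  have M: "W1_objective S p y \<le> ?M" for y using opt unfolding W1_optimal_iff by blast
  \<comment> \<open>Comparison with the point at infinity, whose value is 1.\<close>
  have M0: "0 \<le> ?M" using M[of None] by simp
  have upper: "norm (TRE R s p) \<le> C * ?M" if "P_feasible S C (R, s)" for R s
  proof -
    have R: "R \<in> range rot_matrix" and le: "max_TRE S R s \<le> C" using that unfolding feas by auto
    obtain x where x: "motion_centre R s x" using rotation_has_centre[OF R] by blast
    have "norm (TRE R s p) = max_TRE S R s * W1_objective S p x"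
      by (rule norm_TRE_eq_W1_objective[OF assms(1,2) R x])
    also have "\<dots> \<le> max_TRE S R s * ?M"
      by (intro mult_left_mono M max_TRE_nonneg assms ne)
    also have "\<dots> \<le> C * ?M" by (rule mult_right_mono[OF le M0])
    finally show ?thesis .
  qed
  obtain R' s' where R': "R' \<in> range rot_matrix" "motion_centre R' s' z" "max_TRE S R' s' = C"
    using motion_with_centre_exists[OF assms(1-4)] by blast
  have att: "P_feasible S C (R', s')" unfolding feas using R' by simp
  have val: "norm (TRE R' s' p) = C * ?M"
    using norm_TRE_eq_W1_objective[OF assms(1,2) R'(1,2), of p] R'(3) by simp
  have "P_optimal S p C R s \<longleftrightarrow> P_feasible S C (R, s) \<and> norm (TRE R s p) = C * ?M"
  proof
    assume o: "P_optimal S p C R s"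
    then have f: "P_feasible S C (R, s)" by (simp add: P_optimal_def is_arg_max_def)
    moreover have "\<not> norm (TRE R s p) < norm (TRE R' s' p)"
      using o att by (auto simp: P_optimal_def is_arg_max_def)
    ultimately show "P_feasible S C (R, s) \<and> norm (TRE R s p) = C * ?M"
      using upper[OF f] val by simp
  next
    assume "P_feasible S C (R, s) \<and> norm (TRE R s p) = C * ?M"
    then show "P_optimal S p C R s"
      using upper by (auto simp: P_optimal_def is_arg_max_def not_less)
  qed
  then show ?thesis unfolding feas by simp
qed

theorem theorem6p1:
  fixes S :: "(real^2) set" and p :: "real^2" and C :: real
  assumes "finite S" and "card S \<ge> 2"
    and "general_position S"
    and "0 < C" and "C \<le> 2 * enclosing_radius S"
  shows "(\<exists>x. W1_optimal S p x)
    \<and> (\<exists>R s. P_optimal S p C R s)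
    \<and> (\<forall>R s x. P_optimal S p C R s \<longrightarrow> W1_optimal S p x \<longrightarrow>
          norm (TRE R s p) = C * W1_objective S p x)
    \<and> (\<forall>R\<in>range rot_matrix. \<forall>s. P_optimal S p C R s \<longleftrightarrow>
          (\<exists>x. W1_optimal S p x \<and> motion_centre R s x
             \<and> Max ((\<lambda>y. norm (TRE R s y)) ` S) = C))
    \<and> (\<forall>x. W1_optimal S p x \<longrightarrow>
          (\<exists>R s. P_optimal S p C R s \<and> motion_centre R s x))"
proof -
  obtain z where z: "W1_optimal S p z" using W1_optimal_exists assms by blast
  note P_iff = P_optimal_iff[OF assms(1,2,4,5)]
  note obj = norm_TRE_eq_W1_objective[OF assms(1,2)]
  have construct: "\<exists>R s. P_optimal S p C R s \<and> motion_centre R s x" if x: "W1_optimal S p x" for x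
  proof -
    obtain R s where R: "R \<in> range rot_matrix" "motion_centre R s x" "max_TRE S R s = C"
      using motion_with_centre_exists[OF assms(1,2,4,5)] by blast
    then have "P_optimal S p C R s" using obj[OF R(1,2), of p] by (simp add: P_iff[OF x])
    with R show ?thesis by blast
  qed
  have eqv: "P_optimal S p C R s \<longleftrightarrow>
      (\<exists>x. W1_optimal S p x \<and> motion_centre R s x \<and> max_TRE S R s = C)"
    if R: "R \<in> range rot_matrix" for R s
  proof
    assume "P_optimal S p C R s"
    then have le: "max_TRE S R s \<le> C" and val: "norm (TRE R s p) = C * W1_objective S p z"
      by (simp_all add: P_iff[OF z])
    obtain x where x: "motion_centre R s x" using rotation_has_centre[OF R] by blast
    have M: "W1_objective S p y \<le> W1_objective S p z" for y
      using z by (simp add: W1_optimal_iff)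
    \<comment> \<open>The point at infinity makes the optimum positive, so it may be cancelled
      below.\<close>
    have M1: "1 \<le> W1_objective S p z" using M[of None] by simp
    have eq: "max_TRE S R s * W1_objective S p x = C * W1_objective S p z"
      using obj[OF R x, of p] val by simp
    have "0 \<le> max_TRE S R s" using assms by (intro max_TRE_nonneg) auto
    \<comment> \<open>Replacing the value at \<open>x\<close> by the optimum shows that an optimal
      motion cannot leave slack in the bound C. With largest displacement exactly C,
      \<open>eq\<close> then forces the centre \<open>x\<close> to be optimal.\<close>
    then have "C * W1_objective S p z \<le> max_TRE S R s * W1_objective S p z"
      unfolding eq[symmetric] by (rule mult_left_mono[OF M])
    then have C: "max_TRE S R s = C" using le M1 by simp
    then have "W1_objective S p x = W1_objective S p z" using eq assms by simp
    then have "W1_optimal S p x" using z by (simp add: W1_optimal_iff)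
    with x C show "\<exists>x. W1_optimal S p x \<and> motion_centre R s x \<and> max_TRE S R s = C" by blast
  next
    assume "\<exists>x. W1_optimal S p x \<and> motion_centre R s x \<and> max_TRE S R s = C"
    then obtain x where x: "W1_optimal S p x" "motion_centre R s x" "max_TRE S R s = C" by blast
    then show "P_optimal S p C R s" using obj[OF R x(2), of p] R by (simp add: P_iff[OF x(1)])
  qed
  show ?thesis
    unfolding max_TRE_def[symmetric]
  proof (intro conjI allI ballI impI)
    show "\<exists>x. W1_optimal S p x" using z by blast
    show "\<exists>R s. P_optimal S p C R s" using construct[OF z] by blast
    show "norm (TRE R s p) = C * W1_objective S p x"
      if "P_optimal S p C R s" "W1_optimal S p x" for R s x
      using that(1) by (simp add: P_iff[OF that(2)])
  qed (fact eqv construct)+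
qed

end
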